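(* There is an absolute constant $C>0$ such that the following holds. Let $d\ge 1$, let $B_0,B_1,\ldots,B_d\in\mathbb{Z}^d$, let $S=\mathrm{Conv}(B_0,B_1,\ldots,B_d)$ and let $B=\{B_0,B_1,\ldots,B_d\}$. Then for every vector $b\in \mathrm{int.cone}(S\cap\mathbb{Z}^d)$ there exists an integral vector $\lambda\in\mathbb{Z}_{\ge 0}^{S\cap\mathbb{Z}^d}$ with $b=\sum_{s\in S\cap\mathbb{Z}^d}\lambda_s s$ such that (1) $\lambda_s\le 2^{2^{Cd}}$ for all $s\in (S\cap\mathbb{Z}^d)\setminus B$, and (2) $|\mathrm{supp}(\lambda)\setminus B|\le 2^d$.
   Context: For a polytope $\mathcal{P}\subset\mathbb{R}^d$, $\mathrm{int.cone}(\mathcal{P}\cap\mathbb{Z}^d)=\{\sum_{p\in\mathcal{P}\cap\mathbb{Z}^d}\lambda_p p \mid \lambda\in\mathbb{Z}_{\ge0}^{\mathcal{P}\cap\mathbb{Z}^d}\}$. $\mathrm{Conv}(X)$ denotes the convex hull of $X$. For a vector $\lambda$ indexed by a set $M$, $\mathrm{supp}(\lambda)=\{s\in M\mid \lambda_s\neq 0\}$. *)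

theory Defs
  imports "HOL-Analysis.Analysis" "HOL-Analysis.Finite_Function_Topology"
begin

text \<open>
  The dimension \<open>d\<close> is quantified inside a formula, after a constant that must not depend on it,
  so it cannot be a type. The space of \<open>d\<close>-dimensional real vectors is therefore the coordinate
  subspace of the finitely supported real sequences whose coordinates \<open>i \<ge> d\<close> all vanish.
  The type \<open>nat \<Rightarrow>\<^sub>0 real\<close> of these sequences is an instance of \<open>real_vector\<close>, so the library's
  convex hull applies; the hull of a set of \<open>d\<close>-dimensional vectors stays in the subspace.
\<close>

definition real_vecs :: "nat \<Rightarrow> (nat \<Rightarrow>\<^sub>0 real) set" where
  "real_vecs d = {x. \<forall>i\<ge>d. Poly_Mapping.lookup x i = 0}"

definition int_vecs :: "nat \<Rightarrow> (nat \<Rightarrow>\<^sub>0 real) set" where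
  "int_vecs d = {x \<in> real_vecs d. \<forall>i<d. Poly_Mapping.lookup x i \<in> \<int>}"

text \<open>
  The next definition is meant for finite \<open>M\<close>, such as the set of integral points of a polytope:
  over an infinite set, the library's \<open>sum\<close> is 0. Only the values of \<open>l\<close> on \<open>M\<close> matter, so
  a total function stands for a vector indexed by \<open>M\<close>.
\<close>

definition int_comb :: "'a::real_vector set \<Rightarrow> ('a \<Rightarrow> nat) \<Rightarrow> 'a" where
  "int_comb M l = (\<Sum>p\<in>M. real (l p) *\<^sub>R p)"

definition int_cone :: "'a::real_vector set \<Rightarrow> 'a set" where
  "int_cone M = {int_comb M l | l. True}"

definition supp :: "'a set \<Rightarrow> ('a \<Rightarrow> nat) \<Rightarrow> 'a set" where
  "supp M l = {s \<in> M. l s \<noteq> 0}"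

text \<open>
  For the points of the statement the set \<open>M\<close> is indeed finite, so neither the sum nor \<open>card\<close>
  takes its default value.
\<close>

lemma lookup_scaleR_real:
  "Poly_Mapping.lookup (r *\<^sub>R (x :: nat \<Rightarrow>\<^sub>0 real)) i = r * Poly_Mapping.lookup x i"
proof -
  have "finite {i. r *\<^sub>R Poly_Mapping.lookup x i \<noteq> 0}"
    by (rule finite_subset[OF _ finite_lookup[of x]]) auto
  then show ?thesis
    by (simp add: scaleR_poly_mapping_def)
qed

lemma convex_lookup_le: "convex {x :: nat \<Rightarrow>\<^sub>0 real. \<bar>Poly_Mapping.lookup x i\<bar> \<le> c}"
proof (rule convexI)
  fix x y :: "nat \<Rightarrow>\<^sub>0 real" and u v :: real
  assume xy: "x \<in> {x. \<bar>Poly_Mapping.lookup x i\<bar> \<le> c}" "y \<in> {x. \<bar>Poly_Mapping.lookup x i\<bar> \<le> c}"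
    and uv: "0 \<le> u" "0 \<le> v" "u + v = 1"
  have "\<bar>u * Poly_Mapping.lookup x i + v * Poly_Mapping.lookup y i\<bar>
      \<le> u * \<bar>Poly_Mapping.lookup x i\<bar> + v * \<bar>Poly_Mapping.lookup y i\<bar>"
    using uv abs_triangle_ineq[of "u * Poly_Mapping.lookup x i" "v * Poly_Mapping.lookup y i"]
    by (simp add: abs_mult)
  also have "\<dots> \<le> c"
    using xy uv convex_bound_le by blast
  finally show "u *\<^sub>R x + v *\<^sub>R y \<in> {x. \<bar>Poly_Mapping.lookup x i\<bar> \<le> c}"
    by (simp add: lookup_add lookup_scaleR_real)
qed

lemma convex_hull_real_vecs:
  assumes "B \<subseteq> real_vecs d"
  shows "convex hull B \<subseteq> real_vecs d"
proof (rule hull_minimal[OF assms])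
  show "convex (real_vecs d)"
    by (rule convexI) (simp add: real_vecs_def lookup_add lookup_scaleR_real)
qed

lemma finite_convex_hull_Int_int_vecs:
  assumes "finite B"
  shows "finite (convex hull B \<inter> int_vecs d)"
proof -
  define c where "c = (\<Sum>v\<in>B. \<Sum>i<d. \<bar>Poly_Mapping.lookup v i\<bar>)"
  have hull: "\<bar>Poly_Mapping.lookup x i\<bar> \<le> c" if "x \<in> convex hull B" "i < d" for x i
  proof -
    have "\<bar>Poly_Mapping.lookup v i\<bar> \<le> c" if "v \<in> B" for v
    proof -
      have "\<bar>Poly_Mapping.lookup v i\<bar> \<le> (\<Sum>i<d. \<bar>Poly_Mapping.lookup v i\<bar>)"
        using \<open>i < d\<close> by (intro member_le_sum) auto
      also have "\<dots> \<le> c"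
        unfolding c_def using that assms by (intro member_le_sum) (auto intro: sum_nonneg)
      finally show ?thesis .
    qed
    then have "convex hull B \<subseteq> {x. \<bar>Poly_Mapping.lookup x i\<bar> \<le> c}"
      by (intro hull_minimal convex_lookup_le) auto
    then show ?thesis
      using that by auto
  qed
  let ?M = "convex hull B \<inter> int_vecs d"
  let ?f = "\<lambda>x. restrict (Poly_Mapping.lookup x) {..<d}"
  have "?f ` ?M \<subseteq> ({..<d} \<rightarrow>\<^sub>E {z \<in> \<int>. \<bar>z\<bar> \<le> c})"
    using hull by (auto simp: int_vecs_def split: if_splits)
  moreover have "finite ({..<d} \<rightarrow>\<^sub>E {z \<in> \<int>. \<bar>z\<bar> \<le> c})"
    by (intro finite_PiE) (auto simp: finite_abs_int_segment)
  ultimately have "finite (?f ` ?M)"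
    by (rule finite_subset)
  moreover have "inj_on ?f ?M"
  proof (rule inj_onI)
    fix x y assume xy: "x \<in> ?M" "y \<in> ?M" "?f x = ?f y"
    show "x = y"
    proof (rule poly_mapping_eqI)
      fix i show "Poly_Mapping.lookup x i = Poly_Mapping.lookup y i"
      proof (cases "i < d")
        case True
        then show ?thesis using fun_cong[OF xy(3), of i] by simp
      next
        case False
        then show ?thesis using xy(1,2) by (simp add: int_vecs_def real_vecs_def)
      qed
    qed
  qed
  ultimately show ?thesis
    by (simp add: finite_image_iff)
qed

end

theory Submission
  imports Defs
begin

text \<open>
  Let \<open>s\<close> be an integral point of \<open>S\<close> with barycentric coordinates \<open>x\<close>. A pigeonhole argument
  approximates the large coordinates simultaneously, each with an error of at most half of it; the
  coordinates that are tiny relative to the resulting denominator \<open>K\<close> are rounded down to 0.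
  This gives \<open>f \<le> (K + 1) x\<close> with \<open>sum f = K\<close>, so that \<open>(K + 1) s\<close> equals the vertex combination
  \<open>f\<close> plus one further integral point of \<open>S\<close>. Since the errors are relative, \<open>K\<close> is bounded by a
  product that at most squares (up to a factor) when a coordinate is added to the large ones, and
  so is doubly exponential in the dimension.

  Among the representations of \<open>b\<close> with a fixed total weight, take those of maximal weight on the
  vertices, and among these one that minimises \<open>\<Sum>s. l s * \<parallel>s\<parallel>\<^sup>2\<close>. By the exchange above, the former
  bounds the multiplicities. By the latter no two nonvertices \<open>s\<close>, \<open>t\<close> of the support agree modulo 2,
  as \<open>s + t\<close> could be replaced by twice the midpoint.
\<close>

section \<open>Simultaneous approximation of barycentric coordinates\<close>

text \<open>Pigeonhole: the fractional parts of the multiples \<open>k * x\<close> for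
  \<open>k = 0, ..., P\<close> fall into \<open>P\<close> boxes of side \<open>1 / N v\<close> in
  direction \<open>v\<close>. Two multiples share a box, and their difference gives \<open>K\<close>
  and \<open>f\<close>.\<close>

lemma nonuniform_Dirichlet_approx:
  fixes x :: "'a \<Rightarrow> real" and N :: "'a \<Rightarrow> nat"
  assumes "finite A" and x: "\<And>v. v \<in> A \<Longrightarrow> x v \<ge> 0" and N: "\<And>v. v \<in> A \<Longrightarrow> N v > 0"
  obtains K :: nat and f :: "'a \<Rightarrow> nat"
  where "K \<ge> 1" "K \<le> (\<Prod>v\<in>A. N v)" "\<And>v. v \<in> A \<Longrightarrow> \<bar>real K * x v - real (f v)\<bar> < 1 / real (N v)"
proof -
  define P where "P = (\<Prod>v\<in>A. N v)"
  \<comment> \<open>\<open>F k\<close> is the index of the box; restricting it to \<open>A\<close>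
    makes the number of possible values exactly \<open>P\<close>.\<close>
  define F where "F k = (\<lambda>v\<in>A. nat \<lfloor>real (N v) * frac (real k * x v)\<rfloor>)" for k :: nat
  have "F k \<in> (\<Pi>\<^sub>E v\<in>A. {..<N v})" for k
  proof -
    have "nat \<lfloor>real (N v) * frac (real k * x v)\<rfloor> < N v" if "v \<in> A" for v
    proof -
      have "real (N v) * frac (real k * x v) < real (N v)"
        using N[OF that] frac_lt_1[of "real k * x v"] by simp
      then show ?thesis
        using N[OF that] by (simp add: nat_less_iff floor_less_iff)
    qed
    then show ?thesis by (auto simp: F_def)
  qed
  then have "card (F ` {..P}) \<le> card (\<Pi>\<^sub>E v\<in>A. {..<N v})"
    using \<open>finite A\<close> by (intro card_mono finite_PiE) auto
  also have "\<dots> = P"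
    using \<open>finite A\<close> by (simp add: card_PiE P_def)
  finally have "\<not> inj_on F {..P}"
    by (intro pigeonhole) simp
  then obtain i' j' where "i' \<noteq> j'" "i' \<le> P" "j' \<le> P" "F i' = F j'"
    by (auto simp: inj_on_def)
  then obtain i j where ij: "i < j" "j \<le> P" "F i = F j"
    by (cases "i' < j'") (auto simp: not_less le_less)
  define K where "K = j - i"
  \<comment> \<open>Since \<open>x v\<close> is nonnegative and \<open>i < j\<close>, the difference
    of floors is nonnegative and \<open>nat\<close> does not truncate.\<close>
  define f where "f v = nat (\<lfloor>real j * x v\<rfloor> - \<lfloor>real i * x v\<rfloor>)" for v
  have "\<bar>real K * x v - real (f v)\<bar> < 1 / real (N v)" if v: "v \<in> A" for v
  proof -
    have "real i * x v \<le> real j * x v"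
      using ij x[OF v] by (intro mult_right_mono) auto
    then have f: "real (f v) = of_int \<lfloor>real j * x v\<rfloor> - of_int \<lfloor>real i * x v\<rfloor>"
      by (simp add: f_def floor_mono)
    have K: "real K = real j - real i"
      using ij by (simp add: K_def)
    have "nat \<lfloor>real (N v) * frac (real i * x v)\<rfloor> = nat \<lfloor>real (N v) * frac (real j * x v)\<rfloor>"
      using fun_cong[OF ij(3), of v] v by (simp add: F_def)
    then have "\<lfloor>real (N v) * frac (real i * x v)\<rfloor> = \<lfloor>real (N v) * frac (real j * x v)\<rfloor>"
      by (simp add: eq_nat_nat_iff)
    then have "\<bar>real (N v) * frac (real j * x v) - real (N v) * frac (real i * x v)\<bar> < 1"
      by linarith
    then have "real (N v) * \<bar>frac (real j * x v) - frac (real i * x v)\<bar> < 1"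
      by (simp add: abs_mult flip: right_diff_distrib)
    then have "\<bar>frac (real j * x v) - frac (real i * x v)\<bar> < 1 / real (N v)"
      using N[OF v] by (simp add: field_simps)
    moreover have "frac (real j * x v) - frac (real i * x v) = real K * x v - real (f v)"
      unfolding f K by (simp add: frac_def algebra_simps)
    ultimately show ?thesis by simp
  qed
  then show ?thesis
    using that[of K f] ij by (simp add: K_def P_def)
qed

text \<open>Errors relative to \<open>x v\<close> on the large coordinates \<open>A\<close>, and
  below \<open>1 / (2 * n)\<close> on the others, add up to less than 1 in absolute value. As
  \<open>K - sum f B\<close> is an integer, it must then be 0.\<close>

lemma convex_coeffs_approx:
  fixes x :: "'a \<Rightarrow> real"
  assumes "finite B" and x: "\<And>v. v \<in> B \<Longrightarrow> x v \<ge> 0" and sum_x: "sum x B = 1"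
  obtains K :: nat and f :: "'a \<Rightarrow> nat"
  where "K \<ge> 1" "K \<le> (6 * card B) ^ (2 ^ card B)"
    "\<And>v. v \<in> B \<Longrightarrow> real (f v) \<le> real (K + 1) * x v" "sum f B = K"
proof -
  define n where "n = card B"
  have "B \<noteq> {}" using sum_x by auto
  then have n: "n > 0" using \<open>finite B\<close> by (simp add: n_def card_gt_0_iff)
  \<comment> \<open>This resolution makes the error \<open>1 / N v\<close> at most
    \<open>x v / 2\<close>.\<close>
  define N where "N v = nat \<lceil>2 / x v\<rceil>" for v
  define P where "P A = (\<Prod>v\<in>A. N v)" for A
  \<comment> \<open>The quantity \<open>6 * n * P A\<close> at most squares with each new element of
    \<open>A\<close>, which doubles the exponent; for empty \<open>A\<close> both sides equal
    \<open>6 * n\<close>.\<close>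
  define R where "R A \<longleftrightarrow> A \<subseteq> B \<and> (\<forall>v\<in>A. x v > 0) \<and> 6 * n * P A \<le> (6 * n) ^ (2 ^ card A)" for A
  have "R {}" by (simp add: R_def P_def)
  moreover have "finite {A. R A}"
    by (rule finite_subset[of _ "Pow B"]) (use \<open>finite B\<close> in \<open>auto simp: R_def\<close>)
  ultimately obtain A where "R A" and max: "\<And>A'. R A' \<Longrightarrow> A \<subseteq> A' \<Longrightarrow> A' = A"
    using finite_has_maximal[of "{A. R A}"] by auto
  then have A: "A \<subseteq> B" "\<And>v. v \<in> A \<Longrightarrow> x v > 0" "6 * n * P A \<le> (6 * n) ^ (2 ^ card A)"
    by (auto simp: R_def)
  have "finite A" using A(1) \<open>finite B\<close> finite_subset by blast
  have N: "N v > 0" "2 / x v \<le> real (N v)" "real (N v) \<le> 2 / x v + 1" if "x v > 0" for v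
  proof -
    have "2 / x v > 0" using that by simp
    then show "N v > 0" "2 / x v \<le> real (N v)" "real (N v) \<le> 2 / x v + 1"
      unfolding N_def by linarith+
  qed
  have P: "P A \<ge> 1"
    unfolding P_def using N(1) A(2) by (intro prod_ge_1) (simp add: Suc_leI)
  have small: "x v < 1 / (2 * real n * real (P A))" if v: "v \<in> B - A" for v
  proof (rule ccontr)
    assume "\<not> ?thesis"
    then have ge: "x v \<ge> 1 / (2 * real n * real (P A))" by simp
    have pos: "2 * real n * real (P A) > 0" using n P by simp
    have xv: "x v > 0" using ge pos by (smt (verit) divide_pos_pos)
    have "2 / x v \<le> 4 * real n * real (P A)"
      using ge pos xv by (simp add: field_simps)
    moreover have "1 \<le> real n * real (P A)"
      using n P by (simp add: mult_ge1_I flip: of_nat_mult)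
    \<comment> \<open>Here \<open>2 / x v + 1\<close> is at most
      \<open>4 * n * P A + n * P A\<close>, which explains the factor 6.\<close>
    ultimately have "real (N v) \<le> real (6 * n * P A)"
      using N(3)[OF xv] by simp
    then have "N v \<le> 6 * n * P A" by (simp only: of_nat_le_iff)
    then have "6 * n * P (insert v A) \<le> 6 * n * ((6 * n * P A) * P A)"
      using v \<open>finite A\<close> by (simp add: P_def)
    also have "\<dots> = (6 * n * P A) ^ 2" by (simp add: power2_eq_square)
    also have "\<dots> \<le> ((6 * n) ^ (2 ^ card A)) ^ 2" using A(3) by (rule power_mono) simp
    also have "\<dots> = (6 * n) ^ (2 ^ card A * 2)" by (rule power_mult[symmetric])
    also have "2 ^ card A * 2 = (2 ^ card (insert v A) :: nat)" using v \<open>finite A\<close> by simp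
    finally have "R (insert v A)"
      using A v xv by (auto simp: R_def)
    then show False using max[of "insert v A"] v by auto
  qed
  obtain K f where K: "K \<ge> 1" "K \<le> P A"
    and f: "\<And>v. v \<in> A \<Longrightarrow> \<bar>real K * x v - real (f v)\<bar> < 1 / real (N v)"
    using nonuniform_Dirichlet_approx[of A x N, OF \<open>finite A\<close> less_imp_le[OF A(2)] N(1)[OF A(2)]]
    unfolding P_def by blast
  define g where "g v = (if v \<in> A then f v else 0)" for v
  define e where "e v = real K * x v - real (g v)" for v
  have e_A: "\<bar>e v\<bar> < x v / 2" if v: "v \<in> A" for v
  proof -
    have "1 / real (N v) \<le> x v / 2"
      using N[OF A(2)[OF v]] A(2)[OF v] by (simp add: field_simps)
    then show ?thesis using f[OF v] v by (simp add: e_def g_def)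
  qed
  have e_B: "0 \<le> e v" "e v < 1 / (2 * real n)" if v: "v \<in> B - A" for v
  proof -
    show "0 \<le> e v" using v x by (simp add: e_def g_def)
    have "real K * x v \<le> real (P A) * x v"
      using K x v by (intro mult_right_mono) auto
    also have "\<dots> < real (P A) * (1 / (2 * real n * real (P A)))"
      using small[OF v] P by (intro mult_strict_left_mono) auto
    also have "\<dots> = 1 / (2 * real n)" using P by simp
    finally show "e v < 1 / (2 * real n)" using v by (simp add: e_def g_def)
  qed
  \<comment> \<open>The halves of the \<open>x v\<close> contribute 1/2 in total, and the
    \<open>n\<close> terms \<open>1 / (2 * n)\<close> another 1/2.\<close>
  have "\<bar>sum e B\<bar> \<le> (\<Sum>v\<in>B. \<bar>e v\<bar>)" by (rule sum_abs)
  also have "\<dots> < (\<Sum>v\<in>B. x v / 2 + 1 / (2 * real n))"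
  proof (rule sum_strict_mono[OF \<open>finite B\<close> \<open>B \<noteq> {}\<close>])
    fix v assume v: "v \<in> B"
    have pos: "0 < 1 / (2 * real n)" using n by simp
    show "\<bar>e v\<bar> < x v / 2 + 1 / (2 * real n)"
    proof (cases "v \<in> A")
      case True
      show ?thesis using e_A[OF True] pos by linarith
    next
      case False
      then have "v \<in> B - A" using v by simp
      then show ?thesis using e_B[of v] x[OF v] by linarith
    qed
  qed
  also have "\<dots> = 1"
    using n sum_x by (simp add: sum.distrib flip: sum_divide_distrib n_def)
  finally have abs_e: "\<bar>sum e B\<bar> < 1" .
  have "sum e B = real K * sum x B - real (sum g B)"
    by (simp add: e_def sum_subtractf sum_distrib_left)
  then have "sum e B = real_of_int (int K - int (sum g B))"
    using sum_x by simp
  with abs_e have sum_g: "sum g B = K" by linarith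
  have "real (g v) \<le> real (K + 1) * x v" if v: "v \<in> B" for v
  proof (cases "v \<in> A")
    case True
    \<comment> \<open>Rounding up costs less than \<open>x v / 2\<close>, which the extra copy in
      \<open>K + 1\<close> pays for.\<close>
    have "real (g v) \<le> real K * x v + x v"
      using e_A[OF True] x[OF v] unfolding e_def by linarith
    then show ?thesis by (simp add: algebra_simps)
  next
    case False
    then show ?thesis using x[OF v] by (simp add: g_def)
  qed
  moreover have "K \<le> (6 * card B) ^ (2 ^ card B)"
  proof -
    have "K \<le> 6 * n * P A" using K n by (intro order_trans[OF K(2)]) simp
    also have "\<dots> \<le> (6 * n) ^ (2 ^ card A)" by (rule A(3))
    also have "\<dots> \<le> (6 * n) ^ (2 ^ card B)"
      using n card_mono[OF \<open>finite B\<close> A(1)] by (intro power_increasing) auto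
    finally show ?thesis by (simp add: n_def)
  qed
  ultimately show ?thesis using that K(1) sum_g by blast
qed

text \<open>The coefficients left over after removing \<open>f\<close> are nonnegative and sum to
  \<open>(K + 1) - K = 1\<close>, so the remainder is again a convex combination. Thus
  \<open>K + 1\<close> copies of \<open>s\<close> can be traded for \<open>K\<close> vertices and
  one point of the hull.\<close>

lemma hull_multiple_decomp:
  fixes s :: "'a::real_vector"
  assumes "finite B" and "s \<in> convex hull B"
  obtains K :: nat and f :: "'a \<Rightarrow> nat"
  where "K \<ge> 1" "K \<le> (6 * card B) ^ (2 ^ card B)" "sum f B = K"
    "real (K + 1) *\<^sub>R s - int_comb B f \<in> convex hull B"
proof -
  obtain x where x: "\<And>v. v \<in> B \<Longrightarrow> x v \<ge> 0" "sum x B = 1" and s: "s = (\<Sum>v\<in>B. x v *\<^sub>R v)"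
    using assms by (auto simp: convex_hull_finite)
  obtain K f where Kf: "K \<ge> 1" "K \<le> (6 * card B) ^ (2 ^ card B)"
    "\<And>v. v \<in> B \<Longrightarrow> real (f v) \<le> real (K + 1) * x v" "sum f B = K"
    using convex_coeffs_approx[OF \<open>finite B\<close> x] by blast
  define y where "y v = real (K + 1) * x v - real (f v)" for v
  have "sum y B = real (K + 1) * sum x B - real (sum f B)"
    by (simp add: y_def sum_subtractf sum_distrib_left del: of_nat_add)
  then have "sum y B = 1" using x Kf by simp
  moreover have "real (K + 1) *\<^sub>R s - int_comb B f = (\<Sum>v\<in>B. y v *\<^sub>R v)"
    by (simp add: s int_comb_def y_def scaleR_sum_right sum_subtractf scaleR_diff_left del: of_nat_add)
  moreover have "\<And>v. v \<in> B \<Longrightarrow> 0 \<le> y v" using Kf(3) by (simp add: y_def)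
  ultimately have "real (K + 1) *\<^sub>R s - int_comb B f \<in> convex hull B"
    using \<open>finite B\<close> by (auto simp: convex_hull_finite)
  then show ?thesis using that Kf by blast
qed

section \<open>Exchanges between nonnegative integer combinations\<close>

lemma int_comb_add: "int_comb M (\<lambda>s. l s + g s) = int_comb M l + int_comb M g"
  by (simp add: int_comb_def scaleR_add_left sum.distrib)

lemma int_comb_exchange:
  assumes "\<And>s. g s \<le> l s" and "int_comb M g = int_comb M h"
  shows "int_comb M (\<lambda>s. l s - g s + h s) = int_comb M l"
proof -
  have "int_comb M l = int_comb M (\<lambda>s. (l s - g s) + g s)" using assms(1) by simp
  also have "\<dots> = int_comb M (\<lambda>s. l s - g s + h s)" by (simp only: int_comb_add assms(2))
  finally show ?thesis by simp
qed

text \<open>Moving \<open>sum g X\<close> to the left keeps the identity free of truncated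
  subtraction between sums.\<close>

lemma sum_exchange:
  fixes l g h :: "'a \<Rightarrow> nat"
  assumes "\<And>s. g s \<le> l s"
  shows "(\<Sum>s\<in>X. l s - g s + h s) + sum g X = sum l X + sum h X"
  unfolding sum.distrib[symmetric]
proof (intro sum.cong refl)
  fix s
  show "l s - g s + h s + g s = l s + h s" using assms[of s] by linarith
qed

lemma int_comb_single:
  assumes "finite M" "a \<in> M"
  shows "int_comb M (\<lambda>t. if t = a then k else 0) = real k *\<^sub>R a"
proof -
  have "int_comb M (\<lambda>t. if t = a then k else 0) = (\<Sum>t\<in>M. if t = a then real k *\<^sub>R a else 0)"
    unfolding int_comb_def by (intro sum.cong) auto
  then show ?thesis using assms by simp
qed

lemma int_comb_extend:
  assumes "finite M" "B \<subseteq> M"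
  shows "int_comb M (\<lambda>t. if t \<in> B then f t else 0) = int_comb B f"
  unfolding int_comb_def using assms by (intro sum.mono_neutral_cong_right) auto

section \<open>Integral vectors, midpoints and residues modulo 2\<close>

lemma int_vecs_scale_of_nat: "x \<in> int_vecs d \<Longrightarrow> real k *\<^sub>R x \<in> int_vecs d"
  by (simp add: int_vecs_def real_vecs_def lookup_scaleR_real)

lemma int_vecs_add: "x \<in> int_vecs d \<Longrightarrow> y \<in> int_vecs d \<Longrightarrow> x + y \<in> int_vecs d"
  by (simp add: int_vecs_def real_vecs_def lookup_add)

lemma int_vecs_diff: "x \<in> int_vecs d \<Longrightarrow> y \<in> int_vecs d \<Longrightarrow> x - y \<in> int_vecs d"
  by (simp add: int_vecs_def real_vecs_def lookup_minus)

lemma int_comb_in_int_vecs: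
  assumes "B \<subseteq> int_vecs d"
  shows "int_comb B f \<in> int_vecs d"
proof (cases "finite B")
  case True
  have "(\<Sum>p\<in>B. real (f p) *\<^sub>R p) \<in> int_vecs d"
    using True assms
  proof (induction B rule: finite_induct)
    case empty
    show ?case by (simp add: int_vecs_def real_vecs_def)
  next
    case (insert v B)
    then show ?case by (auto intro: int_vecs_add int_vecs_scale_of_nat)
  qed
  then show ?thesis by (simp add: int_comb_def)
next
  case False
  \<comment> \<open>For infinite \<open>B\<close> the sum defaults to 0, which is integral.\<close>
  then show ?thesis by (simp add: int_comb_def int_vecs_def real_vecs_def)
qed

definition sq_norm :: "nat \<Rightarrow> (nat \<Rightarrow>\<^sub>0 real) \<Rightarrow> real" where
  "sq_norm d x = (\<Sum>i<d. (Poly_Mapping.lookup x i)\<^sup>2)"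

text \<open>By the parallelogram identity the gap is half the squared distance of \<open>s\<close>
  and \<open>t\<close>. Both vectors vanish from coordinate \<open>d\<close> on, so they differ in a
  coordinate that \<open>sq_norm d\<close> sees.\<close>

lemma sq_norm_midpoint:
  assumes "s \<in> real_vecs d" "t \<in> real_vecs d" "s \<noteq> t"
  shows "2 * sq_norm d ((1/2) *\<^sub>R (s + t)) < sq_norm d s + sq_norm d t"
proof -
  obtain i where i: "Poly_Mapping.lookup s i \<noteq> Poly_Mapping.lookup t i"
    using assms(3) poly_mapping_eqI[of s t] by auto
  then have "i < d" using assms(1,2) by (intro not_le_imp_less) (auto simp: real_vecs_def)
  have "0 < (\<Sum>i<d. (Poly_Mapping.lookup s i - Poly_Mapping.lookup t i)\<^sup>2 / 2)"
    using i \<open>i < d\<close> by (intro sum_pos2[of _ i]) auto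
  also have "\<dots> = (\<Sum>i<d. (Poly_Mapping.lookup s i)\<^sup>2 + (Poly_Mapping.lookup t i)\<^sup>2
      - 2 * (Poly_Mapping.lookup ((1/2) *\<^sub>R (s + t)) i)\<^sup>2)"
  proof (intro sum.cong refl)
    fix i
    have "(a - c)\<^sup>2 / 2 = a\<^sup>2 + c\<^sup>2 - 2 * (1/2 * (a + c))\<^sup>2" for a c :: real
      by (simp add: power2_eq_square field_simps)
    then show "(Poly_Mapping.lookup s i - Poly_Mapping.lookup t i)\<^sup>2 / 2
        = (Poly_Mapping.lookup s i)\<^sup>2 + (Poly_Mapping.lookup t i)\<^sup>2
          - 2 * (Poly_Mapping.lookup ((1/2) *\<^sub>R (s + t)) i)\<^sup>2"
      by (simp only: lookup_scaleR_real lookup_add)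
  qed
  also have "\<dots> = sq_norm d s + sq_norm d t - 2 * sq_norm d ((1/2) *\<^sub>R (s + t))"
    by (simp only: sq_norm_def sum.distrib sum_subtractf sum_distrib_left)
  finally show ?thesis by simp
qed

text \<open>The residue class modulo 2 of an integral vector, encoded by its odd coordinates so that
  there are at most \<open>2 ^ d\<close> values. The floor merely turns an integral real into an
  integer.\<close>

definition parity :: "nat \<Rightarrow> (nat \<Rightarrow>\<^sub>0 real) \<Rightarrow> nat set" where
  "parity d x = {i. i < d \<and> odd \<lfloor>Poly_Mapping.lookup x i\<rfloor>}"

lemma midpoint_in_int_vecs:
  assumes s: "s \<in> int_vecs d" and t: "t \<in> int_vecs d" and parity: "parity d s = parity d t"
  shows "(1/2) *\<^sub>R (s + t) \<in> int_vecs d"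
proof -
  have "(Poly_Mapping.lookup s i + Poly_Mapping.lookup t i) / 2 \<in> \<int>" if i: "i < d" for i
  proof -
    obtain a b where a: "Poly_Mapping.lookup s i = of_int a" and b: "Poly_Mapping.lookup t i = of_int b"
      using s t i unfolding int_vecs_def by (blast elim: Ints_cases)
    have "odd a \<longleftrightarrow> odd b"
      using parity i by (auto simp: parity_def set_eq_iff a b dest!: spec[of _ i])
    then have "even (a + b)" by auto
    then obtain c where "a + b = 2 * c" ..
    then have "(of_int a + of_int b) / 2 = (of_int c :: real)"
      by (simp flip: of_int_add)
    then show ?thesis by (simp add: a b)
  qed
  then show ?thesis using s t
    by (simp add: int_vecs_def real_vecs_def lookup_scaleR_real lookup_add)
qed

section \<open>The extremal representation\<close>

text \<open>Exchanges with vertices control the multiplicities, so that bound involves only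
  \<open>card B\<close>; residues modulo 2 control the support, so that bound involves only
  \<open>d\<close>. The points of \<open>B\<close> may be affinely dependent.\<close>

lemma simplex_representation:
  fixes B :: "(nat \<Rightarrow>\<^sub>0 real) set"
  assumes "finite B" and B: "B \<subseteq> int_vecs d"
    and M: "M = convex hull B \<inter> int_vecs d" and b: "b \<in> int_cone M"
  obtains l :: "(nat \<Rightarrow>\<^sub>0 real) \<Rightarrow> nat"
  where "b = int_comb M l" "\<And>s. s \<in> M - B \<Longrightarrow> l s \<le> (6 * card B) ^ (2 ^ card B)"
    "card (supp M l - B) \<le> 2 ^ d"
proof -
  have "finite M" unfolding M by (rule finite_convex_hull_Int_int_vecs[OF \<open>finite B\<close>])
  have BM: "B \<subseteq> M" using B by (auto simp: M hull_inc)
  obtain l0 where l0: "b = int_comb M l0" using b by (auto simp: int_cone_def)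
  \<comment> \<open>The fixed total weight, together with vanishing outside \<open>M\<close>, makes
    \<open>F\<close> finite, so both extrema below are attained.\<close>
  define F where "F = {l. (\<forall>s. s \<notin> M \<longrightarrow> l s = 0) \<and> int_comb M l = b \<and> sum l M = sum l0 M}"
  have "finite F"
  proof (rule finite_subset)
    show "F \<subseteq> {l. \<forall>s. (s \<in> M \<longrightarrow> l s \<in> {..sum l0 M}) \<and> (s \<notin> M \<longrightarrow> l s = 0)}"
    proof (intro subsetI CollectI allI conjI impI)
      fix l s assume l: "l \<in> F"
      show "l s = 0" if "s \<notin> M" using l that by (simp add: F_def)
      show "l s \<in> {..sum l0 M}" if "s \<in> M"
        using member_le_sum[OF that, of l] l \<open>finite M\<close> by (simp add: F_def)
    qed
    show "finite \<dots>" using \<open>finite M\<close> by (intro finite_set_of_finite_funs) auto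
  qed
  define W where "W l = (\<Sum>s\<in>M. real (l s) * sq_norm d s)" for l
  define G where "G = {l \<in> F. sum l B = Max ((\<lambda>l. sum l B) ` F)}"
  have "(\<lambda>s. if s \<in> M then l0 s else 0) \<in> F"
    by (auto simp: F_def l0 int_comb_def intro!: sum.cong)
  then have "F \<noteq> {}" by auto
  then have "Max ((\<lambda>l. sum l B) ` F) \<in> (\<lambda>l. sum l B) ` F"
    using \<open>finite F\<close> by (intro Max_in) auto
  then have "G \<noteq> {}" by (auto simp: G_def)
  have "finite G" using \<open>finite F\<close> by (simp add: G_def)
  define l where "l = arg_min_on W G"
  have "l \<in> G" unfolding l_def using \<open>finite G\<close> \<open>G \<noteq> {}\<close> by (rule arg_min_if_finite(1))
  have W_min: "W l \<le> W l'" if "l' \<in> G" for l'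
    unfolding l_def using \<open>finite G\<close> \<open>G \<noteq> {}\<close> that by (rule arg_min_least)
  have l: "l \<in> F" "int_comb M l = b" "\<And>s. s \<notin> M \<Longrightarrow> l s = 0" "sum l M = sum l0 M"
    using \<open>l \<in> G\<close> by (auto simp: G_def F_def)
  have B_max: "sum l' B \<le> sum l B" if "l' \<in> F" for l'
    using that \<open>l \<in> G\<close> \<open>finite F\<close> by (auto simp: G_def intro!: Max_ge)
  have exchange: "(\<lambda>s. l s - g s + h s) \<in> F"
    if "\<And>s. g s \<le> l s" "\<And>s. s \<notin> M \<Longrightarrow> h s = 0" "int_comb M g = int_comb M h" "sum g M = sum h M"
    for g h
  proof -
    have "int_comb M (\<lambda>s. l s - g s + h s) = int_comb M l"
      using that(1,3) by (rule int_comb_exchange)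
    moreover have "(\<Sum>s\<in>M. l s - g s + h s) = sum l M"
      using sum_exchange[where g = g and l = l and h = h and X = M, OF that(1)] that(4) by simp
    ultimately show ?thesis using l that(2) by (simp add: F_def)
  qed
  have "l s \<le> (6 * card B) ^ (2 ^ card B)" if s: "s \<in> M - B" for s
  proof (rule ccontr)
    assume large: "\<not> ?thesis"
    obtain K f where K: "K \<ge> 1" "K \<le> (6 * card B) ^ (2 ^ card B)" and f: "sum f B = K"
      and hull: "real (K + 1) *\<^sub>R s - int_comb B f \<in> convex hull B"
      using hull_multiple_decomp[OF \<open>finite B\<close>, of s] s M by blast
    define p where "p = real (K + 1) *\<^sub>R s - int_comb B f"
    have "p \<in> int_vecs d" using s B unfolding M p_def
      by (intro int_vecs_diff int_vecs_scale_of_nat int_comb_in_int_vecs) auto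
    then have "p \<in> M" using hull by (simp add: M p_def)
    define g where "g t = (if t = s then K + 1 else 0)" for t
    \<comment> \<open>The two contributions are added because \<open>p\<close> may itself belong to
      \<open>B\<close>.\<close>
    define h where "h t = (if t \<in> B then f t else 0) + (if t = p then 1 else 0)" for t
    \<comment> \<open>As \<open>l s\<close> exceeds the bound on \<open>K\<close>, at least
      \<open>K + 1\<close> copies of \<open>s\<close> are available.\<close>
    have gl: "g t \<le> l t" for t using large K by (auto simp: g_def)
    have "int_comb M g = real (K + 1) *\<^sub>R s"
      unfolding g_def using \<open>finite M\<close> s by (intro int_comb_single) auto
    moreover have "int_comb M h = int_comb B f + p"
      unfolding h_def int_comb_add using \<open>finite M\<close> \<open>p \<in> M\<close> BM
      by (simp add: int_comb_extend int_comb_single)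
    moreover have "sum g M = K + 1" unfolding g_def using \<open>finite M\<close> s by simp
    moreover have "sum h M = K + 1"
    proof -
      have "(\<Sum>t\<in>M. if t \<in> B then f t else 0) = sum f B"
        using \<open>finite M\<close> BM by (intro sum.mono_neutral_cong_right) auto
      then show ?thesis unfolding h_def sum.distrib using \<open>finite M\<close> \<open>p \<in> M\<close> f by simp
    qed
    moreover have "h t = 0" if "t \<notin> M" for t using that BM \<open>p \<in> M\<close> by (auto simp: h_def)
    ultimately have "(\<lambda>t. l t - g t + h t) \<in> F"
      using gl by (intro exchange) (auto simp: p_def)
    then have "(\<Sum>t\<in>B. l t - g t + h t) \<le> sum l B" by (rule B_max)
    \<comment> \<open>The exchange removes no vertex and inserts at least \<open>K\<close>, hence at
      least one, against maximality.\<close>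
    then have "sum h B \<le> sum g B" using sum_exchange[where g = g and l = l and h = h and X = B, OF gl] by simp
    moreover have "sum g B = 0" unfolding g_def using s by (intro sum.neutral) auto
    moreover have "sum h B \<ge> K" unfolding h_def sum.distrib using f by simp
    ultimately show False using K by simp
  qed
  moreover have "card (supp M l - B) \<le> 2 ^ d"
  proof -
    have "inj_on (parity d) (supp M l - B)"
    proof (rule inj_onI, rule ccontr)
      fix s t assume st: "s \<in> supp M l - B" "t \<in> supp M l - B" "parity d s = parity d t" "s \<noteq> t"
      then have sM: "s \<in> M" "l s \<noteq> 0" "s \<notin> B" and tM: "t \<in> M" "l t \<noteq> 0" "t \<notin> B"
        by (auto simp: supp_def)
      define m where "m = (1/2) *\<^sub>R (s + t)"
      have "m \<in> convex hull B"
        using convexD[OF convex_convex_hull[of B], of s t "1/2" "1/2"] sM tM M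
        by (simp add: m_def scaleR_add_right)
      then have "m \<in> M"
        using midpoint_in_int_vecs[of s d t] sM tM st(3) by (simp add: M m_def)
      define g where "g u = (if u = s then 1 else 0) + (if u = t then 1 else 0 :: nat)" for u
      define h where "h u = (if u = m then 2 else 0 :: nat)" for u
      have gl: "g u \<le> l u" for u using sM tM st(4) by (auto simp: g_def)
      have "int_comb M g = s + t"
        unfolding g_def int_comb_add using \<open>finite M\<close> sM tM by (simp add: int_comb_single)
      moreover have "int_comb M h = s + t"
        unfolding h_def using \<open>finite M\<close> \<open>m \<in> M\<close> by (simp add: int_comb_single m_def)
      moreover have "sum g M = 2" "sum h M = 2"
        unfolding g_def h_def sum.distrib using \<open>finite M\<close> sM tM \<open>m \<in> M\<close> by simp_all
      moreover have "h u = 0" if "u \<notin> M" for u using that \<open>m \<in> M\<close> by (auto simp: h_def)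
      ultimately have new: "(\<lambda>u. l u - g u + h u) \<in> F"
        using gl by (intro exchange) auto
      have "sum g B = 0" unfolding g_def using sM tM by (intro sum.neutral) auto
      \<comment> \<open>The vertex weight cannot drop, and by maximality it cannot rise either, even
        if \<open>m\<close> lies in \<open>B\<close>. So the new representation still competes in
        \<open>G\<close>.\<close>
      then have "sum l B \<le> (\<Sum>u\<in>B. l u - g u + h u)" using sum_exchange[where g = g and l = l and h = h and X = B, OF gl] by simp
      then have "(\<Sum>u\<in>B. l u - g u + h u) = sum l B" using B_max[OF new] by simp
      then have "(\<lambda>u. l u - g u + h u) \<in> G" using new \<open>l \<in> G\<close> by (simp add: G_def)
      then have "W l \<le> W (\<lambda>u. l u - g u + h u)" by (rule W_min)
      also have "\<dots> = W l - W g + W h"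
        unfolding W_def sum_subtractf[symmetric] sum.distrib[symmetric]
        by (intro sum.cong refl) (simp only: of_nat_add of_nat_diff[OF gl] distrib_right left_diff_distrib)
      finally have "W g \<le> W h" by simp
      moreover have "W g = sq_norm d s + sq_norm d t"
      proof -
        have "W g = (\<Sum>u\<in>M. (if u = s then sq_norm d s else 0) + (if u = t then sq_norm d t else 0))"
          unfolding W_def by (intro sum.cong) (auto simp: g_def)
        then show ?thesis unfolding sum.distrib using \<open>finite M\<close> sM tM by simp
      qed
      moreover have "W h = 2 * sq_norm d m"
      proof -
        have "W h = (\<Sum>u\<in>M. if u = m then 2 * sq_norm d m else 0)"
          unfolding W_def by (intro sum.cong) (auto simp: h_def)
        then show ?thesis using \<open>finite M\<close> \<open>m \<in> M\<close> by simp
      qed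
      moreover have "2 * sq_norm d m < sq_norm d s + sq_norm d t"
        unfolding m_def using sM tM st(4) by (intro sq_norm_midpoint) (auto simp: M int_vecs_def)
      ultimately show False by simp
    qed
    then have "card (supp M l - B) \<le> card (Pow {..<d})"
      by (rule card_inj_on_le) (auto simp: parity_def)
    then show ?thesis by (simp add: card_Pow)
  qed
  ultimately show ?thesis using that l(2) by blast
qed

section \<open>The absolute constant\<close>

text \<open>From \<open>6 * n \<le> 2 ^ (n + 3)\<close> the inner exponent becomes
  \<open>2 * n + 3\<close>, which is at most \<open>2 * d + 5\<close> and hence at most
  \<open>7 * d\<close> for positive \<open>d\<close>.\<close>

lemma double_exp_bound:
  assumes "d \<ge> 1" "n \<le> d + 1"
  shows "real ((6 * n) ^ (2 ^ n)) \<le> 2 powr (2 powr (7 * real d))"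
proof -
  have pow: "k \<le> 2 ^ k" for k :: nat by (simp add: less_imp_le)
  have "6 * n \<le> 2 ^ 3 * 2 ^ n" using pow[of n] by (intro mult_mono) auto
  also have "\<dots> = 2 ^ (n + 3)" by (simp add: power_add)
  finally have "(6 * n) ^ (2 ^ n) \<le> (2 ^ (n + 3)) ^ (2 ^ n)" by (rule power_mono) simp
  also have "\<dots> = 2 ^ ((n + 3) * 2 ^ n)" by (simp flip: power_mult)
  also have "\<dots> \<le> 2 ^ (2 ^ (7 * d))"
  proof (rule power_increasing)
    have "(n + 3) * 2 ^ n \<le> 2 ^ (n + 3) * 2 ^ n" by (intro mult_right_mono pow) simp
    also have "\<dots> = 2 ^ (2 * n + 3)" 
      unfolding power_add[symmetric] by (rule arg_cong[where f = "power 2"]) simp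
    also have "\<dots> \<le> 2 ^ (7 * d)" using assms by (intro power_increasing) auto
    finally show "(n + 3) * 2 ^ n \<le> (2::nat) ^ (7 * d)" .
  qed simp
  finally have "real ((6 * n) ^ (2 ^ n)) \<le> real (2 ^ (2 ^ (7 * d)))" by (simp only: of_nat_le_iff)
  also have "\<dots> = 2 powr real (2 ^ (7 * d))" by (simp add: powr_realpow del: of_nat_power)
  also have "real (2 ^ (7 * d)) = 2 powr real (7 * d)" by (simp only: powr_realpow zero_less_numeral of_nat_power of_nat_numeral)
  finally show ?thesis by simp
qed

theorem theorem3:
  shows "\<exists>C::real. C > 0 \<and>
    (\<forall>d::nat. \<forall>V :: nat \<Rightarrow> (nat \<Rightarrow>\<^sub>0 real). d \<ge> 1 \<longrightarrow> (\<forall>i\<le>d. V i \<in> int_vecs d) \<longrightarrow>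
      (let B = V ` {..d}; S = convex hull B; M = S \<inter> int_vecs d in
        \<forall>b \<in> int_cone M. \<exists>l :: (nat \<Rightarrow>\<^sub>0 real) \<Rightarrow> nat.
          b = int_comb M l \<and>
          (\<forall>s \<in> M - B. real (l s) \<le> 2 powr (2 powr (C * real d))) \<and>
          card (supp M l - B) \<le> 2 ^ d))"
  unfolding Let_def
proof (intro exI[of _ 7] conjI allI impI ballI)
  show "(0::real) < 7" by simp
  fix d :: nat and V :: "nat \<Rightarrow> (nat \<Rightarrow>\<^sub>0 real)" and b
  let ?B = "V ` {..d}"
  let ?M = "convex hull ?B \<inter> int_vecs d"
  assume d: "d \<ge> 1" and V: "\<forall>i\<le>d. V i \<in> int_vecs d" and b: "b \<in> int_cone ?M"
  \<comment> \<open>\<open>V\<close> may repeat vertices, so this is only an inequality.\<close>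
  have "card ?B \<le> d + 1" using card_image_le[of "{..d}" V] by simp
  then have bound: "real ((6 * card ?B) ^ (2 ^ card ?B)) \<le> 2 powr (2 powr (7 * real d))"
    by (rule double_exp_bound[OF d])
  obtain l where "b = int_comb ?M l" "card (supp ?M l - ?B) \<le> 2 ^ d"
    and l: "\<And>s. s \<in> ?M - ?B \<Longrightarrow> l s \<le> (6 * card ?B) ^ (2 ^ card ?B)"
    using simplex_representation[OF _ _ refl b] V by blast
  moreover have "\<forall>s \<in> ?M - ?B. real (l s) \<le> 2 powr (2 powr (7 * real d))"
    using l bound by (meson of_nat_le_iff order_trans)
  ultimately show "\<exists>l. b = int_comb ?M l \<and>
      (\<forall>s \<in> ?M - ?B. real (l s) \<le> 2 powr (2 powr (7 * real d))) \<and> card (supp ?M l - ?B) \<le> 2 ^ d"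
    by blast
qed

end
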